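(* Let $x\in[0,1]$, let $V_x=\{x\}\times\mathbb{R}$, and let $A\subset V_x$. Let $\mathcal{C}_A=\{f\in\mathcal{C}([0,1]): G(f)\cap A\neq\emptyset\}$. Then $A$ is nowhere dense in $V_x$ if and only if $\mathcal{C}_A$ is nowhere dense in $\mathcal{C}([0,1])$.
   Context: $\mathcal{C}([0,1])$ is the set of all continuous functions $f:[0,1]\to\mathbb{R}$ with the metric $d(f,g)=\max\{|f(t)-g(t)|:t\in[0,1]\}$, and $G(f)=\{(t,f(t)):t\in[0,1]\}$ is the graph of $f$. The line $V_x$ carries the Euclidean metric. A subset of a metric space is nowhere dense if its closure in that space has empty interior. *)

theory Defs
  imports "HOL-Analysis.Analysis" "HOL-Analysis.Urysohn"
begin

text \<open>
  The space of continuous functions from \<open>[0,1]\<close> to the reals. Functions of \<open>cfunspace\<close> are total in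
  HOL but \<open>extensional\<close>, i.e. they take the dummy value \<open>undefined\<close> outside \<open>[0,1]\<close>, so that two of
  them are equal iff they agree on \<open>[0,1]\<close>. Its distance is defined as a supremum; the lemma
  \<open>mdist_C01_is_max\<close> below shows that this supremum is the maximum.
\<close>
definition C01 :: "(real \<Rightarrow> real) metric" where
  "C01 = cfunspace (top_of_set {0..1}) euclidean_metric"

definition graph01 :: "(real \<Rightarrow> real) \<Rightarrow> (real \<times> real) set" where
  "graph01 f = {(t, f t) | t. t \<in> {0..1}}"

definition vline :: "real \<Rightarrow> (real \<times> real) set" where
  "vline x = {x} \<times> UNIV"

text \<open>The line with the Euclidean metric of the plane restricted to it.\<close>
definition vline_metric :: "real \<Rightarrow> (real \<times> real) metric" where
  "vline_metric x = submetric euclidean_metric (vline x)"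

definition C01_meeting :: "(real \<times> real) set \<Rightarrow> (real \<Rightarrow> real) set" where
  "C01_meeting A = {f \<in> mspace C01. graph01 f \<inter> A \<noteq> {}}"

definition nowhere_dense_in :: "'a metric \<Rightarrow> 'a set \<Rightarrow> bool" where
  "nowhere_dense_in m S \<longleftrightarrow>
     S \<subseteq> mspace m \<and> mtopology_of m interior_of (mtopology_of m closure_of S) = {}"

lemma mspace_C01:
  "mspace C01 = {f. continuous_on {0..1} f \<and> f \<in> extensional {0..1}}"
proof -
  have "compactin (top_of_set {0..1::real}) (topspace (top_of_set {0..1::real}))"
    by (simp add: compactin_subtopology)
  from compactin_mspace_cfunspace[OF this, of "euclidean_metric :: real metric"]
  show ?thesis
    by (auto simp: C01_def)
qed

lemma mdist_C01_is_max:
  assumes f: "f \<in> mspace C01" and g: "g \<in> mspace C01"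
  shows "\<exists>t\<in>{0..1}. mdist C01 f g = \<bar>f t - g t\<bar> \<and> (\<forall>s\<in>{0..1}. \<bar>f s - g s\<bar> \<le> \<bar>f t - g t\<bar>)"
proof -
  have "continuous_on {0..1} (\<lambda>t. \<bar>f t - g t\<bar>)"
    using f g by (auto simp: mspace_C01 intro!: continuous_intros)
  then obtain t where t: "t \<in> {0..1}" and max: "\<And>s. s \<in> {0..1} \<Longrightarrow> \<bar>f s - g s\<bar> \<le> \<bar>f t - g t\<bar>"
    using continuous_attains_sup[of "{0..1::real}" "\<lambda>t. \<bar>f t - g t\<bar>"] by auto
  have le: "mdist C01 f g \<le> a \<longleftrightarrow> (\<forall>s\<in>{0..1}. \<bar>f s - g s\<bar> \<le> a)" for a
    using cfunspace_mdist_le[OF f[unfolded C01_def] g[unfolded C01_def], of a]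
    by (simp add: C01_def dist_real_def)
  have "mdist C01 f g = \<bar>f t - g t\<bar>"
    using le[of "mdist C01 f g"] le[of "\<bar>f t - g t\<bar>"] max t by (auto intro: antisym)
  with t max show ?thesis by auto
qed

end

theory Submission
  imports Defs
begin

text \<open>
  The evaluation \<open>f \<mapsto> (x, f x)\<close> maps the function space onto the vertical line; it does not increase
  distances, and it is open because adding a constant \<open>c\<close> to \<open>f\<close> moves \<open>f\<close> by exactly \<open>\<bar>c\<bar>\<close> and
  its value at \<open>x\<close> by \<open>c\<close>. The set of functions meeting \<open>A\<close> is the preimage of \<open>A\<close>, and preimages
  under continuous open maps commute with closure and interior.
\<close>

lemma closure_of_preimage_continuous_open_map:
  assumes "continuous_map X Y f" and "open_map X Y f"
  shows "X closure_of {a \<in> topspace X. f a \<in> S} = {a \<in> topspace X. f a \<in> Y closure_of S}"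
proof
  show "X closure_of {a \<in> topspace X. f a \<in> S} \<subseteq> {a \<in> topspace X. f a \<in> Y closure_of S}"
    by (intro closure_of_minimal closedin_continuous_map_preimage[OF assms(1)] closedin_closure_of)
       (use assms(1) in \<open>auto simp: in_closure_of continuous_map_def Pi_iff\<close>)
  show "{a \<in> topspace X. f a \<in> Y closure_of S} \<subseteq> X closure_of {a \<in> topspace X. f a \<in> S}"
  proof
    fix a assume a: "a \<in> {a \<in> topspace X. f a \<in> Y closure_of S}"
    have "\<exists>b. b \<in> {a \<in> topspace X. f a \<in> S} \<and> b \<in> U" if U: "a \<in> U" "openin X U" for U
    proof -
      from U assms(2) have "openin Y (f ` U)" "f a \<in> f ` U"
        by (auto simp: open_map_def)
      with a obtain b where "b \<in> U" "f b \<in> S"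
        unfolding in_closure_of by blast
      with openin_subset[OF U(2)] show ?thesis by auto
    qed
    with a show "a \<in> X closure_of {a \<in> topspace X. f a \<in> S}"
      by (auto simp: in_closure_of)
  qed
qed

text \<open>Both inclusions use maximality of the interior: openness makes the image of the
  left-hand interior an open part of \<open>S\<close>, and continuity makes the right-hand side
  open.\<close>

lemma interior_of_preimage_continuous_open_map:
  assumes "continuous_map X Y f" and "open_map X Y f"
  shows "X interior_of {a \<in> topspace X. f a \<in> S} = {a \<in> topspace X. f a \<in> Y interior_of S}"
proof
  have "f ` (X interior_of {a \<in> topspace X. f a \<in> S}) \<subseteq> Y interior_of S"
    using assms(2) interior_of_subset[of X "{a \<in> topspace X. f a \<in> S}"]
    by (intro interior_of_maximal) (auto simp: open_map_def)
  then show "X interior_of {a \<in> topspace X. f a \<in> S} \<subseteq> {a \<in> topspace X. f a \<in> Y interior_of S}"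
    using interior_of_subset_topspace[of X] by blast
  show "{a \<in> topspace X. f a \<in> Y interior_of S} \<subseteq> X interior_of {a \<in> topspace X. f a \<in> S}"
    using interior_of_subset[of Y S]
    by (intro interior_of_maximal openin_continuous_map_preimage[OF assms(1)]) auto
qed

lemma nowhere_dense_in_preimage_continuous_open_map:
  assumes cont: "continuous_map (mtopology_of m) (mtopology_of m') f"
    and "open": "open_map (mtopology_of m) (mtopology_of m') f"
    and onto: "f ` mspace m = mspace m'"
    and S: "S \<subseteq> mspace m'"
  shows "nowhere_dense_in m {a \<in> mspace m. f a \<in> S} \<longleftrightarrow> nowhere_dense_in m' S"
proof -
  have "mtopology_of m interior_of (mtopology_of m closure_of {a \<in> mspace m. f a \<in> S})
      = {a \<in> mspace m. f a \<in> mtopology_of m' interior_of (mtopology_of m' closure_of S)}"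
    using closure_of_preimage_continuous_open_map[OF cont "open", of S]
      interior_of_preimage_continuous_open_map[OF cont "open", of "mtopology_of m' closure_of S"]
    by simp
  \<comment> \<open>Surjectivity enters here: each point of the interior in \<open>m'\<close> is hit
    by \<open>f\<close>, so the interior is empty as soon as its preimage is.\<close>
  moreover have "mtopology_of m' interior_of T \<subseteq> f ` mspace m" for T
    using interior_of_subset_topspace[of "mtopology_of m'" T] onto by simp
  ultimately show ?thesis
    using S unfolding nowhere_dense_in_def by blast
qed

lemma openin_mtopology_of:
  "openin (mtopology_of m) U \<longleftrightarrow> U \<subseteq> mspace m \<and> (\<forall>a\<in>U. \<exists>r>0. mball_of m a r \<subseteq> U)"
proof -
  interpret Metric_space "mspace m" "mdist m"
    by (rule Metric_space_mspace_mdist)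
  show ?thesis
    by (auto simp: mtopology_of_def mball_of_def openin_mtopology)
qed

text \<open>Lifting without increase of distance means that the ball of radius \<open>r\<close>
  about \<open>f a\<close> is covered by the image of the ball of the same radius about
  \<open>a\<close>.\<close>

lemma open_map_mtopology_of:
  assumes "f \<in> mspace m \<rightarrow> mspace m'"
    and lift: "\<And>a y. a \<in> mspace m \<Longrightarrow> y \<in> mspace m' \<Longrightarrow>
           \<exists>b\<in>mspace m. f b = y \<and> mdist m a b \<le> mdist m' (f a) y"
  shows "open_map (mtopology_of m) (mtopology_of m') f"
  unfolding open_map_def
proof (intro allI impI)
  fix U assume U: "openin (mtopology_of m) U"
  show "openin (mtopology_of m') (f ` U)"
    unfolding openin_mtopology_of
  proof (intro conjI ballI)
    show "f ` U \<subseteq> mspace m'"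
      using assms(1) U by (auto simp: openin_mtopology_of)
  next
    fix z assume "z \<in> f ` U"
    then obtain a where a: "a \<in> U" "z = f a" by auto
    with U obtain r where r: "r > 0" "mball_of m a r \<subseteq> U" and am: "a \<in> mspace m"
      unfolding openin_mtopology_of by blast
    have "mball_of m' z r \<subseteq> f ` U"
    proof
      fix y assume y: "y \<in> mball_of m' z r"
      with lift[OF am, of y] a obtain b
        where "b \<in> mspace m" "f b = y" "mdist m a b < r" by force
      with r am show "y \<in> f ` U" by auto
    qed
    with r show "\<exists>r>0. mball_of m' z r \<subseteq> f ` U" by auto
  qed
qed

lemma mspace_vline_metric: "mspace (vline_metric x) = {x} \<times> UNIV"
  by (simp add: vline_metric_def vline_def)

lemma mdist_vline_metric: "mdist (vline_metric x) (x, s) (x, t) = \<bar>s - t\<bar>"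
  by (simp add: vline_metric_def dist_Pair_Pair dist_real_def)

text \<open>The difference of two functions at \<open>x\<close> is at most its maximum over the
  interval, so evaluation is Lipschitz with constant 1.\<close>

lemma continuous_map_evaluation:
  assumes "x \<in> {0..1}"
  shows "continuous_map (mtopology_of C01) (mtopology_of (vline_metric x)) (\<lambda>f. (x, f x))"
proof (intro Lipschitz_continuous_imp_continuous_map)
  have "mdist (vline_metric x) (x, f x) (x, g x) \<le> mdist C01 f g"
    if "f \<in> mspace C01" "g \<in> mspace C01" for f g
    using mdist_C01_is_max[OF that] assms by (auto simp: mdist_vline_metric)
  then show "Lipschitz_continuous_map C01 (vline_metric x) (\<lambda>f. (x, f x))"
    unfolding Lipschitz_continuous_map_def
    by (intro conjI exI[of _ 1]) (auto simp: mspace_vline_metric)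
qed

text \<open>Members of \<open>C01\<close> are extensional, so functions given by a formula, such as
  the shifts and constants below, must first be restricted.\<close>

lemma restrict_in_mspace_C01:
  assumes "continuous_on {0..1} f"
  shows "restrict f {0..1} \<in> mspace C01"
proof -
  have "continuous_on {0..1} (restrict f {0..1})"
    using assms by (rule continuous_on_eq) simp
  then show ?thesis
    by (simp add: mspace_C01)
qed

lemma evaluation_lift:
  assumes f: "f \<in> mspace C01" and x: "x \<in> {0..1}"
  shows "\<exists>g\<in>mspace C01. g x = c \<and> mdist C01 f g = \<bar>f x - c\<bar>"
proof
  \<comment> \<open>The shift is constant, so the difference from \<open>f\<close> has the same
    absolute value at every point; wherever the maximum is attained, it equals its value at
    \<open>x\<close>.\<close>
  let ?g = "restrict (\<lambda>t. f t + (c - f x)) {0..1}"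
  show g: "?g \<in> mspace C01"
    using f by (intro restrict_in_mspace_C01 continuous_intros) (simp add: mspace_C01)
  show "?g x = c \<and> mdist C01 f ?g = \<bar>f x - c\<bar>"
    using mdist_C01_is_max[OF f g] x by auto
qed

lemma open_map_evaluation:
  assumes "x \<in> {0..1}"
  shows "open_map (mtopology_of C01) (mtopology_of (vline_metric x)) (\<lambda>f. (x, f x))"
proof (rule open_map_mtopology_of)
  fix f y assume "f \<in> mspace C01" "y \<in> mspace (vline_metric x)"
  then show "\<exists>g\<in>mspace C01. (x, g x) = y \<and> mdist C01 f g \<le> mdist (vline_metric x) (x, f x) y"
    using evaluation_lift[OF _ assms, of f "snd y"]
    by (cases y) (force simp: mspace_vline_metric mdist_vline_metric)
qed (simp add: mspace_vline_metric)

lemma evaluation_image_C01: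
  assumes "x \<in> {0..1}"
  shows "(\<lambda>f. (x, f x)) ` mspace C01 = mspace (vline_metric x)"
proof -
  have "(x, c) \<in> (\<lambda>f. (x, f x)) ` mspace C01" for c
    using assms restrict_in_mspace_C01[OF continuous_on_const, of c]
    by (intro image_eqI[of _ _ "restrict (\<lambda>_. c) {0..1}"]) simp_all
  then show ?thesis
    by (auto simp: mspace_vline_metric)
qed

text \<open>Since \<open>A\<close> lies above \<open>x\<close>, a graph can meet it only at
  parameter \<open>x\<close>, and \<open>x\<close> in [0,1] ensures that the graph has a point
  there.\<close>

lemma C01_meeting_eq_preimage:
  assumes "x \<in> {0..1}" and "A \<subseteq> vline x"
  shows "C01_meeting A = {f \<in> mspace C01. (x, f x) \<in> A}"
  using assms by (fastforce simp: C01_meeting_def graph01_def vline_def)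

theorem proposition5p1:
  fixes x :: real and A :: "(real \<times> real) set"
  assumes "x \<in> {0..1}" and "A \<subseteq> vline x"
  shows "nowhere_dense_in (vline_metric x) A \<longleftrightarrow> nowhere_dense_in C01 (C01_meeting A)"
proof -
  have "A \<subseteq> mspace (vline_metric x)"
    using assms(2) by (simp add: mspace_vline_metric vline_def)
  from nowhere_dense_in_preimage_continuous_open_map[OF continuous_map_evaluation[OF assms(1)]
      open_map_evaluation[OF assms(1)] evaluation_image_C01[OF assms(1)] this]
  show ?thesis
    by (simp add: C01_meeting_eq_preimage[OF assms])
qed

end
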